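(* Let $K,U,N,N_{RF}$ be positive integers, let $G=(V,E)$ be an interference graph (finite, simple, undirected) with node set $V=\{v_{k,u}: 1\le k\le K,\ 1\le u\le U\}$, and let requirements $d_{k,u}$ be integers with $0\le d_{k,u}\le N$ and $\sum_{u=1}^U d_{k,u}=N_{RF}N$ for every $k$. Suppose that (i) there is no clique of $G$ with node set $\{v_{k_q,u_q}\}_q$ such that $\sum_q d_{k_q,u_q}>N$; and (ii) $G$ contains no empty cycle with $4$ or more nodes. Then the RF-chain-sufficient Scheduling Algorithm described in the context achieves $n_0=\sum_{(k,u)}(d_{k,u}-|T_{k,u}|)=0$ for problem P2; that is, the sets $T_{k,u}$ it outputs satisfy $|T_{k,u}|=d_{k,u}$ for all $k,u$.
   Context: Setting: node $v_{k,u}$ represents the $u$th user of cell $k$. The edge joining $v_{k,u}$ and $v_{k',u'}$ is denoted $e_{(k,u),(k',u')}$; it indicates that the two users must not be served in the same time slot. There are $N$ time slots $\{1,\dots,N\}$. Problem P2 (each user has its own exclusive RF chain): choose sets $T_{k,u}\subset\{1,\dots,N\}$ (the time slots in which user $v_{k,u}$ is served) to minimize $n_0=\sum_{(k,u)}(d_{k,u}-|T_{k,u}|)$ subject to $|T_{k,u}|\le d_{k,u}$ for all $k,u$, and $T_{k,u}\cap T_{k',u'}=\emptyset$ whenever $e_{(k,u),(k',u')}\in E$. A clique is a set of nodes any two of which are adjacent. An empty cycle is a cycle in $G$ in which each node is not adjacent to any other node of the cycle except its two neighbours along the cycle (i.e. a chordless, induced cycle; a cycle of length 3 is an empty cycle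 and is the same as a 3-node clique). RF-chain-sufficient Scheduling Algorithm. For each connected component $G_i=(V_i,E_i)$ of $G$ (isolated nodes count as components) do: 1. Select one node $v_{k_0,u_0}\in V_i$ and let $T_{k_0,u_0}$ consist of $d_{k_0,u_0}$ elements selected from $\{1,\dots,N\}$. Set $V_i^t=\{v_{k_0,u_0}\}$ (the set of already traversed nodes). 2. While $V_i^t\neq V_i$: among the nodes of $V_i\setminus V_i^t$ that are adjacent to some node of $V_i^t$, select a node $v_{k,u}$ with the maximum number of neighbours in $V_i^t$. Compute the set of available time slots $$T'_{k,u}=\{1,\dots,N\}\setminus\bigcup_{v_{k',u'}\in V_i^t,\ e_{(k,u),(k',u')}\in E}T_{k',u'},$$ let $T_{k,u}$ consist of $\min\{|T'_{k,u}|,d_{k,u}\}$ elements selected from $T'_{k,u}$, and replace $V_i^t$ by $V_i^t\cup\{v_{k,u}\}$. Choices not specified (initial node, ties, which elements are selected) are arbitrary. *)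

theory Defs
  imports Main
begin

text \<open>A pair \<open>(k, u)\<close> stands for user \<open>u\<close> of cell \<open>k\<close>; edges are two-element sets of users.\<close>

type_synonym user = "nat \<times> nat"

definition users :: "nat \<Rightarrow> nat \<Rightarrow> user set" where
  "users K U = {1..K} \<times> {1..U}"

definition simple_graph :: "'a set \<Rightarrow> 'a set set \<Rightarrow> bool" where
  "simple_graph V E \<longleftrightarrow> finite V \<and> (\<forall>e\<in>E. e \<subseteq> V \<and> card e = 2)"

definition clique :: "'a set \<Rightarrow> 'a set set \<Rightarrow> 'a set \<Rightarrow> bool" where
  "clique V E C \<longleftrightarrow> C \<subseteq> V \<and> (\<forall>x\<in>C. \<forall>y\<in>C. x \<noteq> y \<longrightarrow> {x, y} \<in> E)"

text \<open>The list contains each node of the cycle once; indices are taken modulo its length.\<close>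

definition empty_cycle :: "'a set \<Rightarrow> 'a set set \<Rightarrow> 'a list \<Rightarrow> bool" where
  "empty_cycle V E c \<longleftrightarrow>
     3 \<le> length c \<and> distinct c \<and> set c \<subseteq> V \<and>
     (\<forall>i<length c. {c ! i, c ! (Suc i mod length c)} \<in> E) \<and>
     (\<forall>i<length c. \<forall>j<length c. {c ! i, c ! j} \<in> E \<longrightarrow>
        j = Suc i mod length c \<or> i = Suc j mod length c)"

definition components :: "'a set \<Rightarrow> 'a set set \<Rightarrow> 'a set set" where
  "components V E = V // {(x, y) \<in> V \<times> V. (x, y) \<in> {(a, b). {a, b} \<in> E}\<^sup>*}"

definition nbrs_in :: "'a set set \<Rightarrow> 'a set \<Rightarrow> 'a \<Rightarrow> 'a set" where
  "nbrs_in E W v = {w \<in> W. {v, w} \<in> E}"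

definition available :: "nat \<Rightarrow> 'a set set \<Rightarrow> 'a set \<Rightarrow> ('a \<Rightarrow> nat set) \<Rightarrow> 'a \<Rightarrow> nat set" where
  "available N E W T v = {1..N} - (\<Union>w\<in>nbrs_in E W v. T w)"

text \<open>
  \<open>sched_reach N E d C W T\<close>: some sequence of choices on the component \<open>C\<close> leads to a state in
  which exactly the nodes of \<open>W\<close> have been traversed, with slots \<open>T\<close>. All choices the algorithm
  leaves open are nondeterministic. The value of \<open>T\<close> outside \<open>W\<close> is never read.
\<close>

inductive sched_reach ::
  "nat \<Rightarrow> 'a set set \<Rightarrow> ('a \<Rightarrow> nat) \<Rightarrow> 'a set \<Rightarrow> 'a set \<Rightarrow> ('a \<Rightarrow> nat set) \<Rightarrow> bool"
  for N :: nat and E :: "'a set set" and d :: "'a \<Rightarrow> nat" and C :: "'a set"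
where
  start: "\<lbrakk>v \<in> C; S \<subseteq> {1..N}; card S = d v\<rbrakk>
    \<Longrightarrow> sched_reach N E d C {v} ((\<lambda>_. {})(v := S))"
| step: "\<lbrakk>sched_reach N E d C W T; W \<noteq> C;
     v \<in> C - W; nbrs_in E W v \<noteq> {};
     \<forall>w\<in>C - W. nbrs_in E W w \<noteq> {} \<longrightarrow> card (nbrs_in E W w) \<le> card (nbrs_in E W v);
     S \<subseteq> available N E W T v;
     card S = min (card (available N E W T v)) (d v)\<rbrakk>
    \<Longrightarrow> sched_reach N E d C (insert v W) (T(v := S))"

definition sched_output ::
  "nat \<Rightarrow> 'a set \<Rightarrow> 'a set set \<Rightarrow> ('a \<Rightarrow> nat) \<Rightarrow> ('a \<Rightarrow> nat set) \<Rightarrow> bool" where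
  "sched_output N V E d T \<longleftrightarrow>
     (\<forall>C\<in>components V E. \<exists>T'. sched_reach N E d C C T' \<and> (\<forall>v\<in>C. T v = T' v))"

definition P2_feasible ::
  "nat \<Rightarrow> 'a set \<Rightarrow> 'a set set \<Rightarrow> ('a \<Rightarrow> nat) \<Rightarrow> ('a \<Rightarrow> nat set) \<Rightarrow> bool" where
  "P2_feasible N V E d T \<longleftrightarrow>
     (\<forall>v\<in>V. T v \<subseteq> {1..N} \<and> card (T v) \<le> d v) \<and>
     (\<forall>v\<in>V. \<forall>w\<in>V. {v, w} \<in> E \<longrightarrow> T v \<inter> T w = {})"

text \<open>Integer-valued, so that the subtraction is not truncated.\<close>

definition P2_objective :: "'a set \<Rightarrow> ('a \<Rightarrow> nat) \<Rightarrow> ('a \<Rightarrow> nat set) \<Rightarrow> int" where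
  "P2_objective V d T = (\<Sum>v\<in>V. int (d v) - int (card (T v)))"

text \<open>The algorithm never gets stuck, so a statement about all its outputs is not vacuous.\<close>

lemma sched_reach_complete:
  assumes "finite V" "\<And>v. v \<in> V \<Longrightarrow> d v \<le> N" "C \<in> components V E" "simple_graph V E"
  shows "\<exists>T. sched_reach N E d C C T"
proof -
  let ?R = "{(a, b). {a, b} \<in> E}"
  from assms(3) obtain x where x: "x \<in> V" and C: "C = {y \<in> V. (x, y) \<in> ?R\<^sup>*}"
    unfolding components_def quotient_def by auto
  have finC: "finite C" and xC: "x \<in> C" using C assms(1) x by auto
  have EV: "b \<in> V" if "{a, b} \<in> E" for a b
    using assms(4) that unfolding simple_graph_def by blast
  have base: "\<exists>T. sched_reach N E d C {x} T"
  proof -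
    have "d x \<le> card {1..N}" using assms(2) x by simp
    then obtain S where "S \<subseteq> {1..N}" "card S = d x" by (meson obtain_subset_with_card_n)
    then show ?thesis using sched_reach.start xC by metis
  qed
  have ex: "\<exists>W T. sched_reach N E d C W T \<and> x \<in> W \<and> W \<subseteq> C \<and> card W = Suc n"
    if "Suc n \<le> card C" for n
    using that
  proof (induction n)
    case 0
    show ?case using base xC by fastforce
  next
    case (Suc n)
    then obtain W T where W: "sched_reach N E d C W T" "x \<in> W" "W \<subseteq> C" "card W = Suc n"
      by auto
    have ne: "W \<noteq> C" using W Suc by auto
    let ?A = "{v \<in> C - W. nbrs_in E W v \<noteq> {}}"
    have "?A \<noteq> {}"
    proof
      assume A: "?A = {}"
      have "y \<in> W" if "(x, y) \<in> ?R\<^sup>*" for y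
        using that
      proof (induction rule: rtrancl_induct)
        case base
        then show ?case using W by simp
      next
        case (step y z)
        then have "z \<in> C" using C EV by (auto intro: rtrancl_into_rtrancl)
        moreover have "y \<in> nbrs_in E W z"
          using step by (auto simp: nbrs_in_def insert_commute)
        ultimately show ?case using A by blast
      qed
      then show False using C W ne by blast
    qed
    moreover have "finite ?A" using finC by simp
    ultimately obtain v where v: "v \<in> ?A"
      "\<forall>w\<in>?A. card (nbrs_in E W w) \<le> card (nbrs_in E W v)"
      using Max_in[of "(\<lambda>w. card (nbrs_in E W w)) ` ?A"] 
        Max_ge[of "(\<lambda>w. card (nbrs_in E W w)) ` ?A"]
      by (smt (verit, best) finite_imageI imageE image_eqI image_is_empty)
    obtain S where S: "S \<subseteq> available N E W T v"
      "card S = min (card (available N E W T v)) (d v)"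
      by (meson min.cobounded1 obtain_subset_with_card_n)
    have "sched_reach N E d C (insert v W) (T(v := S))"
      using sched_reach.step[OF W(1) ne] v S by blast
    moreover have "card (insert v W) = Suc (Suc n)"
      using W v finC by (simp add: finite_subset)
    moreover have "insert v W \<subseteq> C" using W v by blast
    ultimately show ?case using W(2) by blast
  qed
  obtain n where n: "card C = Suc n"
    using finC xC by (metis card_gt_0_iff empty_iff gr0_implies_Suc)
  from ex[of n] n obtain W T where "sched_reach N E d C W T" "W \<subseteq> C" "card W = card C"
    by auto
  moreover have "W = C" using card_subset_eq finC calculation by blast
  ultimately show ?thesis by blast
qed

lemma sched_output_exists:
  assumes "simple_graph V E" "\<And>v. v \<in> V \<Longrightarrow> d v \<le> N"
  shows "\<exists>T. sched_output N V E d T"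
proof -
  let ?R = "{(x, y) \<in> V \<times> V. (x, y) \<in> {(a, b). {a, b} \<in> E}\<^sup>*}"
  have "sym {(a, b). {a, b} \<in> E}" by (auto simp: sym_def insert_commute)
  then have "sym ({(a, b). {a, b} \<in> E}\<^sup>*)" by (rule sym_rtrancl)
  then have eq: "equiv V ?R"
    by (intro equivI) (auto simp: refl_on_def sym_def trans_def intro: rtrancl_trans)
  have "\<forall>C\<in>components V E. \<exists>T. sched_reach N E d C C T"
    using assms sched_reach_complete unfolding simple_graph_def by metis
  then obtain f where f: "\<forall>C\<in>components V E. sched_reach N E d C C (f C)" by metis
  have "?R `` {v} = C" if "C \<in> components V E" "v \<in> C" for C v
    using that eq unfolding components_def
    by (metis (no_types, lifting) Image_singleton_iff equiv_class_eq quotientE)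
  then have "sched_output N V E d (\<lambda>v. f (?R `` {v}) v)"
    unfolding sched_output_def using f by (metis (no_types, lifting))
  then show ?thesis by blast
qed

end

theory Submission
  imports Defs
begin

text \<open>
  Condition (ii) says that the graph is chordal and the algorithm is a maximum cardinality search.
  As in the theorem of Tarjan and Yannakakis, the search keeps the invariant that no induced path
  with at least one interior node has both ends among the traversed nodes and its interior outside
  of them. Applied to paths of three nodes, this says that the traversed neighbours of the next node
  \<open>v\<close> form a clique, which remains one when \<open>v\<close> is added. By condition (i) these neighbours occupy
  at most \<open>N - d v\<close> slots, so \<open>v\<close> gets all the slots that it requires.
\<close>

section \<open>Induced paths and the cycles that close them\<close>

definition induced_path :: "'a set set \<Rightarrow> 'a list \<Rightarrow> bool" where
  "induced_path E p \<longleftrightarrow> distinct p \<and>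
     (\<forall>i<length p. \<forall>j<length p. {p ! i, p ! j} \<in> E \<longleftrightarrow> j = Suc i \<or> i = Suc j)"

text \<open>An edge between two traversed nodes is an induced path without interior; the bound 3 on
  the length keeps it from counting as a violation.\<close>

definition no_outer_path :: "'a set set \<Rightarrow> 'a set \<Rightarrow> bool" where
  "no_outer_path E W \<longleftrightarrow>
     \<not> (\<exists>p. induced_path E p \<and> 3 \<le> length p \<and> hd p \<in> W \<and> last p \<in> W \<and>
           (\<forall>i. 0 < i \<and> i < length p - 1 \<longrightarrow> p ! i \<notin> W))"

lemma simple_graph_edgeD:
  assumes "simple_graph V E" "{x, y} \<in> E"
  shows "x \<in> V" "y \<in> V" "x \<noteq> y"
  using assms by (auto simp: simple_graph_def)

lemma induced_path_rev:
  assumes "induced_path E p"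
  shows "induced_path E (rev p)"
  unfolding induced_path_def
proof (intro conjI allI impI)
  show "distinct (rev p)"
    using assms by (simp add: induced_path_def)
  fix i j assume ij: "i < length (rev p)" "j < length (rev p)"
  let ?r = "\<lambda>k. length p - Suc k"
  have "?r i < length p" "?r j < length p"
    using ij by auto
  then have "{p ! ?r i, p ! ?r j} \<in> E \<longleftrightarrow> ?r j = Suc (?r i) \<or> ?r i = Suc (?r j)"
    using assms unfolding induced_path_def by blast
  also have "\<dots> \<longleftrightarrow> j = Suc i \<or> i = Suc j"
    using ij by auto
  finally show "{rev p ! i, rev p ! j} \<in> E \<longleftrightarrow> j = Suc i \<or> i = Suc j"
    using ij by (simp add: rev_nth)
qed

lemma induced_path_take:
  assumes "induced_path E p"
  shows "induced_path E (take n p)"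
  using assms by (simp add: induced_path_def)

lemma induced_path_snoc:
  assumes "simple_graph V E" "induced_path E q" "q \<noteq> []" "x \<notin> set q"
    and adj: "\<And>i. i < length q \<Longrightarrow> {q ! i, x} \<in> E \<longleftrightarrow> Suc i = length q"
  shows "induced_path E (q @ [x])"
  unfolding induced_path_def
proof (intro conjI allI impI)
  show "distinct (q @ [x])"
    using assms by (simp add: induced_path_def)
  fix i j assume ij: "i < length (q @ [x])" "j < length (q @ [x])"
  have "{x, x} \<notin> E"
    using simple_graph_edgeD(3)[OF assms(1)] by blast
  moreover have "{x, q ! i} \<in> E \<longleftrightarrow> Suc i = length q" if "i < length q" for i
    using adj[OF that] by (simp add: insert_commute)
  ultimately show "{(q @ [x]) ! i, (q @ [x]) ! j} \<in> E \<longleftrightarrow> j = Suc i \<or> i = Suc j"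
    using ij adj assms(2) unfolding induced_path_def by (auto simp: nth_append less_Suc_eq)
qed

text \<open>A node that sees only the two ends of an induced path closes it without creating a
  chord. With at least two nodes in \<open>q\<close> these ends differ, so the result is a genuine
  cycle.\<close>

lemma empty_cycle_snoc:
  assumes "simple_graph V E" "induced_path E q" "2 \<le> length q" "x \<notin> set q"
    and adj: "\<And>i. i < length q \<Longrightarrow> {q ! i, x} \<in> E \<longleftrightarrow> i = 0 \<or> Suc i = length q"
  shows "empty_cycle V E (q @ [x])"
  unfolding empty_cycle_def
proof (intro conjI allI impI)
  let ?c = "q @ [x]"
  have adj': "{x, q ! i} \<in> E \<longleftrightarrow> i = 0 \<or> Suc i = length q" if "i < length q" for i
    using adj[OF that] by (simp add: insert_commute)
  have loop: "{x, x} \<notin> E"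
    using simple_graph_edgeD(3)[OF assms(1)] by blast
  have pq: "{q ! i, q ! j} \<in> E \<longleftrightarrow> j = Suc i \<or> i = Suc j" if "i < length q" "j < length q" for i j
    using assms(2) that by (simp add: induced_path_def)
  show "3 \<le> length ?c"
    using assms(3) by simp
  show "distinct ?c"
    using assms by (simp add: induced_path_def)
  show edge: "{?c ! i, ?c ! (Suc i mod length ?c)} \<in> E" if i: "i < length ?c" for i
  proof (cases "Suc i < length q")
    case True
    then show ?thesis using pq by (simp add: nth_append)
  next
    case False
    \<comment> \<open>The remaining edges are those at \<open>x\<close>: from the last node of
      \<open>q\<close> to \<open>x\<close>, and from \<open>x\<close> around to
      \<open>q ! 0\<close>.\<close>
    then consider "Suc i = length q" | "i = length q"
      using i by fastforce
    then show ?thesis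
    proof cases
      case 1
      then have "i < length q" "Suc i mod length ?c = length q" by simp_all
      then show ?thesis using adj[of i] 1 by (simp add: nth_append)
    next
      case 2
      then have "Suc i mod length ?c = 0" by simp
      moreover have "0 < length q" using assms(3) by linarith
      ultimately show ?thesis using adj'[of 0] 2 by (simp add: nth_append)
    qed
  qed
  \<comment> \<open>Each node of the cycle lies on one of its edges, and edges stay inside
    \<open>V\<close>.\<close>
  show "set ?c \<subseteq> V"
    using edge simple_graph_edgeD(1)[OF assms(1)] by (metis in_set_conv_nth subsetI)
  fix i j assume ij: "i < length ?c" "j < length ?c" and e: "{?c ! i, ?c ! j} \<in> E"
  consider "i < length q" "j < length q" | "i = length q" "j < length q"
    | "i < length q" "j = length q" | "i = length q" "j = length q"
    using ij by force
  then show "j = Suc i mod length ?c \<or> i = Suc j mod length ?c"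
  proof cases
    case 1
    then show ?thesis using e pq[of i j] by (auto simp: nth_append)
  next
    case 2
    then show ?thesis using e adj'[of j] by (auto simp: nth_append)
  next
    case 3
    then show ?thesis using e adj[of i] by (auto simp: nth_append)
  next
    case 4
    then show ?thesis using e loop by simp
  qed
qed

section \<open>The search invariant and the cliques it yields\<close>

text \<open>
  A new bad path \<open>p\<close> must end in \<open>v\<close>. Its start is adjacent to \<open>p ! 1\<close> but not to \<open>v\<close>, so by the
  maximality of \<open>v\<close> some \<open>x \<in> W\<close> is adjacent to \<open>v\<close> but not to \<open>p ! 1\<close>. Leaving \<open>p\<close> for \<open>x\<close> as early
  as possible after its start gives an empty cycle or a bad path for \<open>W\<close>, depending on whether \<open>x\<close>
  is adjacent to the start.
\<close>

lemma no_outer_path_insert: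
  assumes graph: "simple_graph V E"
    and chordal: "\<not> (\<exists>c. empty_cycle V E c \<and> length c \<ge> 4)"
    and inv: "no_outer_path E W" and fin: "finite W" and "v \<notin> W"
    and max: "\<And>w. w \<notin> W \<Longrightarrow> nbrs_in E W w \<noteq> {} \<Longrightarrow>
      card (nbrs_in E W w) \<le> card (nbrs_in E W v)"
  shows "no_outer_path E (insert v W)"
proof -
  have no_path_from_W: False
    if p: "induced_path E p" "3 \<le> length p" "hd p \<in> W" "last p = v"
      and interior: "\<And>i. 0 < i \<Longrightarrow> i < length p - 1 \<Longrightarrow> p ! i \<notin> insert v W" for p
  proof -
    have pe: "{p ! i, p ! j} \<in> E \<longleftrightarrow> j = Suc i \<or> i = Suc j"
      if "i < length p" "j < length p" for i j
      using p(1) that by (simp add: induced_path_def)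
    have "p \<noteq> []"
      using p(2) by auto
    then have p0: "p ! 0 \<in> W" and pl: "p ! (length p - 1) = v"
      using p(3,4) by (simp_all add: hd_conv_nth last_conv_nth)
    \<comment> \<open>The last node \<open>v\<close> is included, since it has not been traversed
      yet.\<close>
    have outside: "p ! i \<notin> W" if "0 < i" "i < length p" for i
      using interior[of i] that pl \<open>v \<notin> W\<close> by (cases "i = length p - 1") auto
    have "{p ! 1, p ! 0} \<in> E" "{v, p ! 0} \<notin> E"
      using pe[of 1 0] pe[of "length p - 1" 0] p(2) pl \<open>p \<noteq> []\<close> by auto
    then have a: "p ! 0 \<in> nbrs_in E W (p ! 1)" "p ! 0 \<notin> nbrs_in E W v"
      using p0 by (auto simp: nbrs_in_def)
    then have "card (nbrs_in E W (p ! 1)) \<le> card (nbrs_in E W v)"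
      using max outside[of 1] p(2) by auto
    moreover have "finite (nbrs_in E W u)" for u
      using fin by (simp add: nbrs_in_def)
    \<comment> \<open>Inclusion together with the cardinality bound would force equality, but
      \<open>p ! 0\<close> belongs to only one of the two sets.\<close>
    ultimately have "\<not> nbrs_in E W v \<subseteq> nbrs_in E W (p ! 1)"
      using a card_seteq by blast
    then obtain x where x: "x \<in> W" "{v, x} \<in> E" "{p ! 1, x} \<notin> E"
      by (auto simp: nbrs_in_def)
    \<comment> \<open>Index 0 is left out because adjacency of \<open>x\<close> to the start is
      decided by cases below. The last index qualifies, as \<open>x\<close> is adjacent to
      \<open>v\<close>.\<close>
    define j where "j = (LEAST j. 0 < j \<and> j < length p \<and> {p ! j, x} \<in> E)"
    have "\<exists>j. 0 < j \<and> j < length p \<and> {p ! j, x} \<in> E"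
      using pl x(2) p(2) by (intro exI[of _ "length p - 1"]) auto
    then have j: "0 < j" "j < length p" "{p ! j, x} \<in> E"
      unfolding j_def by (metis (mono_tags, lifting) LeastI_ex)+
    have before_j: "{p ! i, x} \<notin> E" if "0 < i" "i < j" for i
      using not_less_Least[of i "\<lambda>j. 0 < j \<and> j < length p \<and> {p ! j, x} \<in> E"] that j(2)
      unfolding j_def by auto
    \<comment> \<open>This puts at least three nodes in the prefix ending at \<open>p ! j\<close>,
      so a cycle closed by \<open>x\<close> has at least four.\<close>
    have j2: "2 \<le> j"
      using j x(3) by (cases "j = 1") auto
    let ?q = "take (Suc j) p"
    have q: "induced_path E ?q" "length ?q = Suc j"
      using induced_path_take[OF p(1)] j(2) by auto
    \<comment> \<open>All nodes of \<open>p\<close> after the start are outside \<open>W\<close>, so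
      the start is the only one that \<open>x\<close> could coincide with; \<open>v\<close> is
      adjacent to \<open>x\<close> but not to the start.\<close>
    have "x \<noteq> p ! 0"
      using x(2) \<open>{v, p ! 0} \<notin> E\<close> by blast
    then have "x \<noteq> p ! i" if "i < length p" for i
      using outside[of i] that x(1) by (cases "i = 0") auto
    then have xq: "x \<notin> set ?q"
      by (metis in_set_conv_nth in_set_takeD)
    show False
    proof (cases "{p ! 0, x} \<in> E")
      case True
      have "{?q ! i, x} \<in> E \<longleftrightarrow> i = 0 \<or> Suc i = length ?q" if "i < length ?q" for i
        using that q(2) True j(3) before_j[of i] by (cases "i = 0"; cases "i = j") auto
      then have "empty_cycle V E (?q @ [x])"
        using empty_cycle_snoc[OF graph q(1) _ xq] q(2) j2 by auto
      moreover have "length (?q @ [x]) \<ge> 4"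
        using q(2) j2 by simp
      ultimately show False
        using chordal by blast
    next
      case False
      have "{?q ! i, x} \<in> E \<longleftrightarrow> Suc i = length ?q" if "i < length ?q" for i
        using that q(2) False j(1,3) before_j[of i] by (cases "i = 0"; cases "i = j") auto
      then have "induced_path E (?q @ [x])"
        using induced_path_snoc[OF graph q(1) _ xq] q(2) \<open>p \<noteq> []\<close> by auto
      moreover have "hd (?q @ [x]) \<in> W"
        using p(3) \<open>p \<noteq> []\<close> by (cases p) auto
      moreover have "(?q @ [x]) ! i \<notin> W" if "0 < i" "i < length (?q @ [x]) - 1" for i
        using that q(2) outside[of i] j(2) by (simp add: nth_append)
      ultimately show False
        using inv x(1) j2 q(2) unfolding no_outer_path_def
        by (metis One_nat_def Suc_le_mono add.commute last_snoc le_SucI length_append_singleton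
            numeral_2_eq_2 numeral_3_eq_3)
    qed
  qed
  show ?thesis
    unfolding no_outer_path_def
  proof (rule notI, elim exE conjE)
    fix p
    assume p: "induced_path E p" "3 \<le> length p" "hd p \<in> insert v W" "last p \<in> insert v W"
      and interior: "\<forall>i. 0 < i \<and> i < length p - 1 \<longrightarrow> p ! i \<notin> insert v W"
    have "p \<noteq> []"
      using p(2) by auto
    \<comment> \<open>Distinct ends cannot both be \<open>v\<close>, which leaves three cases;
      reversal turns the last into the second.\<close>
    have "hd p \<noteq> last p"
      using p(1,2) \<open>p \<noteq> []\<close>
      by (simp add: induced_path_def hd_conv_nth last_conv_nth nth_eq_iff_index_eq)
    then consider "hd p \<in> W" "last p \<in> W" | "hd p \<in> W" "last p = v" | "last p \<in> W" "hd p = v"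
      using p(3,4) by auto
    then show False
    proof cases
      case 1
      then show False
        using inv p(1,2) interior unfolding no_outer_path_def by blast
    next
      case 2
      then show False
        using no_path_from_W p(1,2) interior by blast
    next
      case 3
      have "rev p ! i \<notin> insert v W" if "0 < i" "i < length (rev p) - 1" for i
      proof -
        have "0 < length p - Suc i" "length p - Suc i < length p - 1"
          using that by auto
        then show ?thesis
          using interior that by (simp add: rev_nth)
      qed
      then show False
        using no_path_from_W[of "rev p"] induced_path_rev[OF p(1)] p(2) 3 \<open>p \<noteq> []\<close>
        by (simp add: hd_rev last_rev)
    qed
  qed
qed

lemma no_outer_path_singleton: "no_outer_path E {v}"
  unfolding no_outer_path_def
proof (rule notI, elim exE conjE)
  fix p :: "'a list"
  assume p: "induced_path E p" "3 \<le> length p" "hd p \<in> {v}" "last p \<in> {v}"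
  then have "p \<noteq> []" by auto
  then have "hd p \<noteq> last p"
    using p(1,2) by (simp add: induced_path_def hd_conv_nth last_conv_nth nth_eq_iff_index_eq)
  then show False
    using p(3,4) by simp
qed

text \<open>Otherwise \<open>[a, v, b]\<close> would be an induced path whose only interior node is
  untraversed.\<close>

lemma no_outer_path_nbrs_adjacent:
  assumes graph: "simple_graph V E" and inv: "no_outer_path E W" and "v \<notin> W"
    and "a \<in> nbrs_in E W v" "b \<in> nbrs_in E W v" "a \<noteq> b"
  shows "{a, b} \<in> E"
proof (rule ccontr)
  assume "{a, b} \<notin> E"
  have ab: "a \<in> W" "b \<in> W" "{v, a} \<in> E" "{v, b} \<in> E"
    using assms(4,5) by (auto simp: nbrs_in_def)
  have loop: "{x} \<notin> E" for x
    using simple_graph_edgeD(3)[OF graph, of x x] by auto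
  have "induced_path E [a, v, b]"
    unfolding induced_path_def
    using ab \<open>{a, b} \<notin> E\<close> \<open>a \<noteq> b\<close> \<open>v \<notin> W\<close> loop
    by (auto simp: less_Suc_eq insert_commute)
  then show False
    using inv ab \<open>v \<notin> W\<close> unfolding no_outer_path_def
    by (auto simp: less_Suc_eq dest!: spec[of _ "[a, v, b]"])
qed

section \<open>Slot counting along a run on one component\<close>

lemma card_available_ge:
  assumes "finite W" and card_T: "\<And>w. w \<in> W \<Longrightarrow> T w \<subseteq> {1..N} \<and> card (T w) = d w"
    and "d v + (\<Sum>w\<in>nbrs_in E W v. d w) \<le> N"
  shows "d v \<le> card (available N E W T v)"
proof -
  let ?U = "\<Union>w\<in>nbrs_in E W v. T w"
  have fin: "finite (nbrs_in E W v)"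
    using assms(1) by (simp add: nbrs_in_def)
  \<comment> \<open>The union bound holds even where the slot sets of neighbours overlap.\<close>
  have "card ?U \<le> (\<Sum>w\<in>nbrs_in E W v. card (T w))"
    using fin by (rule card_UN_le)
  also have "\<dots> = (\<Sum>w\<in>nbrs_in E W v. d w)"
    using card_T by (intro sum.cong) (auto simp: nbrs_in_def)
  finally have "card ?U \<le> (\<Sum>w\<in>nbrs_in E W v. d w)" .
  moreover have "card (available N E W T v) = N - card ?U"
  proof -
    have "?U \<subseteq> {1..N}"
      using card_T by (auto simp: nbrs_in_def)
    then show ?thesis
      unfolding available_def by (simp add: card_Diff_subset finite_subset)
  qed
  ultimately show ?thesis
    using assms(3) by linarith
qed

text \<open>The clauses support each other in the induction: \<open>no_outer_path\<close> makes the
  traversed neighbours of the next node a clique, and the exact counts on \<open>W\<close> turn the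
  weight of that clique into a bound on occupied slots.\<close>

lemma sched_reach_invariant:
  assumes graph: "simple_graph V E"
    and light: "\<not> (\<exists>C. clique V E C \<and> (\<Sum>v\<in>C. d v) > N)"
    and chordal: "\<not> (\<exists>c. empty_cycle V E c \<and> length c \<ge> 4)"
    and C: "C \<subseteq> V" "\<forall>v\<in>C. \<forall>w. {v, w} \<in> E \<longrightarrow> w \<in> C"
    and reach: "sched_reach N E d C W T"
  shows "W \<subseteq> C \<and> no_outer_path E W \<and> (\<forall>w\<in>W. T w \<subseteq> {1..N} \<and> card (T w) = d w) \<and>
    (\<forall>x\<in>W. \<forall>y\<in>W. {x, y} \<in> E \<longrightarrow> T x \<inter> T y = {})"
  using reach
proof induction
  case (start v S)
  have "{v} \<notin> E"
    using simple_graph_edgeD(3)[OF graph, of v v] by auto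
  then show ?case
    using start no_outer_path_singleton by auto
next
  case (step W T v S)
  from step.IH have WC: "W \<subseteq> C" and inv: "no_outer_path E W"
    and card_T: "\<And>w. w \<in> W \<Longrightarrow> T w \<subseteq> {1..N} \<and> card (T w) = d w"
    and disj: "\<And>x y. x \<in> W \<Longrightarrow> y \<in> W \<Longrightarrow> {x, y} \<in> E \<Longrightarrow> T x \<inter> T y = {}"
    by auto
  have v: "v \<in> C" "v \<notin> W"
    using step.hyps by auto
  have fin: "finite W"
    using WC C(1) graph by (auto simp: simple_graph_def intro: finite_subset)
  \<comment> \<open>The algorithm maximizes only over \<open>C - W\<close>. An outside node with a
    neighbour in \<open>W\<close> lies in \<open>C\<close> anyway, because \<open>C\<close> is
    closed under adjacency.\<close>
  have "card (nbrs_in E W w) \<le> card (nbrs_in E W v)" if "w \<notin> W" "nbrs_in E W w \<noteq> {}" for w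
  proof -
    have "w \<in> C"
      using that(2) WC C(2) by (fastforce simp: nbrs_in_def insert_commute)
    then show ?thesis
      using step.hyps that by blast
  qed
  then have inv': "no_outer_path E (insert v W)"
    using no_outer_path_insert[OF graph chordal inv fin v(2)] by blast
  let ?A = "nbrs_in E W v"
  have "clique V E (insert v ?A)"
    unfolding clique_def
    using no_outer_path_nbrs_adjacent[OF graph inv v(2)] v(1) WC C(1)
    by (auto simp: nbrs_in_def insert_commute)
  then have "(\<Sum>w\<in>insert v ?A. d w) \<le> N"
    using light by (meson not_le)
  moreover have "finite ?A" "v \<notin> ?A"
    using fin v(2) by (auto simp: nbrs_in_def)
  ultimately have "d v \<le> card (available N E W T v)"
    using card_available_ge[OF fin card_T] by simp
  then have S: "card S = d v" "S \<subseteq> {1..N}"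
    using step.hyps by (auto simp: available_def)
  have S_disj: "S \<inter> T w = {}" if "w \<in> W" "{v, w} \<in> E" for w
    using step.hyps that by (auto simp: available_def nbrs_in_def)
  have "(T(v := S)) x \<inter> (T(v := S)) y = {}"
    if "x \<in> insert v W" "y \<in> insert v W" "{x, y} \<in> E" for x y
  proof -
    \<comment> \<open>So at most one of the two is the newly served \<open>v\<close>.\<close>
    have "x \<noteq> y"
      using simple_graph_edgeD(3)[OF graph] that(3) by blast
    then show ?thesis
      using that S_disj[of x] S_disj[of y] disj[of x y] by (auto simp: insert_commute)
  qed
  then show ?case
    using WC v(1) inv' card_T S by auto
qed

section \<open>From the components to the whole graph\<close>

lemma components_closed:
  assumes "simple_graph V E" "C \<in> components V E" "v \<in> C" "{v, w} \<in> E"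
  shows "w \<in> C"
  using assms simple_graph_edgeD(2)[OF assms(1,4)]
  by (auto simp: components_def quotient_def intro: rtrancl_into_rtrancl)

lemma components_cover:
  assumes "v \<in> V"
  shows "\<exists>C\<in>components V E. v \<in> C"
  using assms by (fastforce simp: components_def quotient_def)

lemma components_subset:
  assumes "C \<in> components V E"
  shows "C \<subseteq> V"
  using assms by (auto simp: components_def quotient_def)

theorem theorem1:
  fixes K U N N_RF :: nat
    and E :: "user set set"
    and d :: "user \<Rightarrow> nat"
    and T :: "user \<Rightarrow> nat set"
  assumes "K > 0" "U > 0" "N > 0" "N_RF > 0"
    and graph: "simple_graph (users K U) E"
    and d_le: "\<forall>v\<in>users K U. d v \<le> N"
    and d_sum: "\<forall>k\<in>{1..K}. (\<Sum>u=1..U. d (k, u)) = N_RF * N"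
    and no_heavy_clique: "\<not> (\<exists>C. clique (users K U) E C \<and> (\<Sum>v\<in>C. d v) > N)"
    and no_empty_cycle: "\<not> (\<exists>c. empty_cycle (users K U) E c \<and> length c \<ge> 4)"
    and run: "sched_output N (users K U) E d T"
  shows "P2_feasible N (users K U) E d T
    \<and> P2_objective (users K U) d T = 0
    \<and> (\<forall>v\<in>users K U. card (T v) = d v)"
proof -
  let ?V = "users K U"
  have component: "\<forall>w\<in>C. T w \<subseteq> {1..N} \<and> card (T w) = d w"
    "\<forall>x\<in>C. \<forall>y\<in>C. {x, y} \<in> E \<longrightarrow> T x \<inter> T y = {}"
    if C: "C \<in> components ?V E" for C
  proof -
    obtain T' where T': "sched_reach N E d C C T'" "\<forall>v\<in>C. T v = T' v"
      using run C unfolding sched_output_def by blast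
    have "\<forall>v\<in>C. \<forall>w. {v, w} \<in> E \<longrightarrow> w \<in> C"
      using components_closed[OF graph C] by blast
    note sched_reach_invariant[OF graph no_heavy_clique no_empty_cycle components_subset[OF C]
        this T'(1)]
    then show "\<forall>w\<in>C. T w \<subseteq> {1..N} \<and> card (T w) = d w"
      "\<forall>x\<in>C. \<forall>y\<in>C. {x, y} \<in> E \<longrightarrow> T x \<inter> T y = {}"
      using T'(2) by auto
  qed
  have served: "T v \<subseteq> {1..N} \<and> card (T v) = d v" if "v \<in> ?V" for v
    using components_cover[OF that] component(1) by blast
  \<comment> \<open>No edge joins two components, so their independent runs cannot conflict.\<close>
  have "T v \<inter> T w = {}" if "v \<in> ?V" "{v, w} \<in> E" for v w
    using components_cover[OF that(1)] components_closed[OF graph _ _ that(2)] component(2) that(2)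
    by blast
  then show ?thesis
    using served by (simp add: P2_feasible_def P2_objective_def)
qed

end
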